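(* Let $(\mathfrak h,[\cdot,\cdot]_{\mathfrak h})$ be a Leibniz algebra. Then $\Xi(\mathfrak h)$ is a sub-Leibniz algebra of $(\mathfrak{Der}(\mathfrak h),[\cdot,\cdot]_s)$.
   Context: All vector spaces are over a fixed ground field. A (left) Leibniz algebra is a vector space with a bilinear bracket satisfying $[x,[y,z]]=[[x,y],z]+[y,[x,z]]$. The left center is $\mathrm Z(\mathfrak h)=\{\alpha\in\mathfrak h:[\alpha,\beta]_{\mathfrak h}=0\ \forall\beta\in\mathfrak h\}$. $\mathrm{Der}^L(\mathfrak h)=\{D\in\mathfrak{gl}(\mathfrak h): D[\alpha,\beta]_{\mathfrak h}=[D\alpha,\beta]_{\mathfrak h}+[\alpha,D\beta]_{\mathfrak h}\}$, $\mathrm{Der}^R(\mathfrak h)=\{D\in\mathfrak{gl}(\mathfrak h): D[\alpha,\beta]_{\mathfrak h}=[\alpha,D\beta]_{\mathfrak h}-[\beta,D\alpha]_{\mathfrak h}\}$. $\mathfrak{Der}(\mathfrak h)=\mathrm{Der}^L(\mathfrak h)\oplus\mathrm{Der}^R(\mathfrak h)$ is a Leibniz algebra with bracket $[(D^L_1,D^R_1),(D^L_2,D^R_2)]_s=([D^L_1,D^L_2],[D^L_1,D^R_2])$, where $[D_1,D_2]=D_1D_2-D_2D_1$. $\Xi(\mathfrak h)=\{(D^L,D^R)\in\mathfrak{Der}(\mathfrak h): D^L\alpha+D^R\alpha\in\mathrm Z(\mathfrak h)\ \forall\alpha\in\mathfrak h,\text{ and }D^R\mathrm Z(\mathfrak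 h)=0\}$. *)

theory Defs
  imports Complex_Main "HOL-Library.Function_Algebras" "HOL-Library.Product_Plus"
begin

text \<open>
  Leibniz algebras are carried by a linear subspace \<open>A\<close> of an ambient vector space type, so that
  one notion covers both an arbitrary Leibniz algebra (\<open>A = UNIV\<close>) and algebras whose
  elements are cut out by a condition, such as derivations. The values of \<open>br\<close> outside \<open>A\<close>
  are irrelevant.
\<close>

locale leibniz_algebra_on = vector_space scale
  for scale :: "'k::field \<Rightarrow> 'v::ab_group_add \<Rightarrow> 'v" +
  fixes A :: "'v set" and br :: "'v \<Rightarrow> 'v \<Rightarrow> 'v"
  assumes subspace_carrier: "subspace A"
    and br_closed: "\<And>x y. x \<in> A \<Longrightarrow> y \<in> A \<Longrightarrow> br x y \<in> A"
    and br_add_left: "\<And>x y z. x \<in> A \<Longrightarrow> y \<in> A \<Longrightarrow> z \<in> A \<Longrightarrow> br (x + y) z = br x z + br y z"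
    and br_add_right: "\<And>x y z. x \<in> A \<Longrightarrow> y \<in> A \<Longrightarrow> z \<in> A \<Longrightarrow> br x (y + z) = br x y + br x z"
    and br_scale_left: "\<And>c x y. x \<in> A \<Longrightarrow> y \<in> A \<Longrightarrow> br (scale c x) y = scale c (br x y)"
    and br_scale_right: "\<And>c x y. x \<in> A \<Longrightarrow> y \<in> A \<Longrightarrow> br x (scale c y) = scale c (br x y)"
    and leibniz: "\<And>x y z. x \<in> A \<Longrightarrow> y \<in> A \<Longrightarrow> z \<in> A \<Longrightarrow>
      br x (br y z) = br (br x y) z + br y (br x z)"

definition sub_leibniz_algebra ::
  "('k::field \<Rightarrow> 'v::ab_group_add \<Rightarrow> 'v) \<Rightarrow> 'v set \<Rightarrow> ('v \<Rightarrow> 'v \<Rightarrow> 'v) \<Rightarrow> 'v set \<Rightarrow> bool" where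
  "sub_leibniz_algebra scale A br B \<longleftrightarrow>
     leibniz_algebra_on scale A br \<and> B \<subseteq> A \<and> module.subspace scale B \<and>
     (\<forall>x\<in>B. \<forall>y\<in>B. br x y \<in> B)"

definition left_center :: "('h \<Rightarrow> 'h \<Rightarrow> 'h::zero) \<Rightarrow> 'h set" where
  "left_center br = {a. \<forall>b. br a b = 0}"

definition gl :: "('k::field \<Rightarrow> 'h::ab_group_add \<Rightarrow> 'h) \<Rightarrow> ('h \<Rightarrow> 'h) set" where
  "gl scale = {D. Vector_Spaces.linear scale scale D}"

definition commutator :: "('h \<Rightarrow> 'h) \<Rightarrow> ('h \<Rightarrow> 'h) \<Rightarrow> 'h \<Rightarrow> 'h::ab_group_add" where
  "commutator D1 D2 = (D1 \<circ> D2) - (D2 \<circ> D1)"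

definition Der_L ::
  "('k::field \<Rightarrow> 'h::ab_group_add \<Rightarrow> 'h) \<Rightarrow> ('h \<Rightarrow> 'h \<Rightarrow> 'h) \<Rightarrow> ('h \<Rightarrow> 'h) set" where
  "Der_L scale br = {D \<in> gl scale. \<forall>a b. D (br a b) = br (D a) b + br a (D b)}"

definition Der_R ::
  "('k::field \<Rightarrow> 'h::ab_group_add \<Rightarrow> 'h) \<Rightarrow> ('h \<Rightarrow> 'h \<Rightarrow> 'h) \<Rightarrow> ('h \<Rightarrow> 'h) set" where
  "Der_R scale br = {D \<in> gl scale. \<forall>a b. D (br a b) = br a (D b) - br b (D a)}"

text \<open>
  The direct sum is external: its elements are pairs of maps, with the componentwise and pointwise
  addition supplied by the imported type class instances and the scalar multiplication below.
\<close>

definition Der ::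
  "('k::field \<Rightarrow> 'h::ab_group_add \<Rightarrow> 'h) \<Rightarrow> ('h \<Rightarrow> 'h \<Rightarrow> 'h) \<Rightarrow> (('h \<Rightarrow> 'h) \<times> ('h \<Rightarrow> 'h)) set" where
  "Der scale br = Der_L scale br \<times> Der_R scale br"

definition Der_scale ::
  "('k \<Rightarrow> 'h \<Rightarrow> 'h) \<Rightarrow> 'k \<Rightarrow> ('h \<Rightarrow> 'h) \<times> ('h \<Rightarrow> 'h) \<Rightarrow> ('h \<Rightarrow> 'h) \<times> ('h \<Rightarrow> 'h)" where
  "Der_scale scale c P = ((\<lambda>a. scale c (fst P a)), (\<lambda>a. scale c (snd P a)))"

definition Der_bracket ::
  "('h \<Rightarrow> 'h) \<times> ('h \<Rightarrow> 'h) \<Rightarrow> ('h \<Rightarrow> 'h) \<times> ('h \<Rightarrow> 'h) \<Rightarrow> ('h \<Rightarrow> 'h) \<times> ('h \<Rightarrow> 'h::ab_group_add)" where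
  "Der_bracket P Q = (commutator (fst P) (fst Q), commutator (fst P) (snd Q))"

definition Xi ::
  "('k::field \<Rightarrow> 'h::ab_group_add \<Rightarrow> 'h) \<Rightarrow> ('h \<Rightarrow> 'h \<Rightarrow> 'h) \<Rightarrow> (('h \<Rightarrow> 'h) \<times> ('h \<Rightarrow> 'h)) set" where
  "Xi scale br = {(DL, DR) \<in> Der scale br.
     (\<forall>a. DL a + DR a \<in> left_center br) \<and> (\<forall>z \<in> left_center br. DR z = 0)}"

end

theory Submission imports Defs begin

text \<open>
  Bilinearity of the bracket on \<open>Der\<close> is linearity of the commutator, and its Leibniz rule is the
  Jacobi identity of the commutator in both components; closure holds because the commutator of a
  left derivation with a left (right) derivation is again a left (right) derivation.

  For \<open>\<Xi>\<close> the decisive fact is that a left derivation maps the left center \<open>Z\<close> into itself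
  (lemma \<open>Der_L_left_center\<close>). If \<open>(L\<^sub>1, R\<^sub>1)\<close> and \<open>(L\<^sub>2, R\<^sub>2)\<close> are in \<open>\<Xi>\<close>, the two components of
  their bracket add up to
  \<open>[L\<^sub>1, L\<^sub>2] + [L\<^sub>1, R\<^sub>2] = L\<^sub>1 \<circ> (L\<^sub>2 + R\<^sub>2) - (L\<^sub>2 + R\<^sub>2) \<circ> L\<^sub>1\<close>.
  Both terms on the right take values in \<open>Z\<close>: the first because \<open>L\<^sub>2 + R\<^sub>2\<close> does and \<open>L\<^sub>1\<close>
  preserves \<open>Z\<close>, the second because \<open>L\<^sub>2 + R\<^sub>2\<close> does. Likewise \<open>[L\<^sub>1, R\<^sub>2]\<close> vanishes on \<open>Z\<close>, since
  \<open>R\<^sub>2\<close> does and \<open>L\<^sub>1\<close> preserves \<open>Z\<close>.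
\<close>

locale leibniz_algebra = leibniz_algebra_on scale UNIV br
  for scale :: "'k::field \<Rightarrow> 'h::ab_group_add \<Rightarrow> 'h" and br
begin

lemma br_add: "br (x + y) z = br x z + br y z" "br x (y + z) = br x y + br x z"
  by (simp_all add: br_add_left br_add_right)

lemma br_scale: "br (scale c x) y = scale c (br x y)" "br x (scale c y) = scale c (br x y)"
  by (simp_all add: br_scale_left br_scale_right)

lemma br_zero: "br 0 y = 0" "br x 0 = 0"
  using br_add(1)[of 0 0 y] br_add(2)[of x 0 0] by simp_all

lemma br_diff: "br (x - y) z = br x z - br y z" "br x (y - z) = br x y - br x z"
  using br_add(1)[of "x - y" y z] br_add(2)[of x "y - z" z] by (simp_all add: algebra_simps)

lemma subspace_left_center: "subspace (left_center br)"
  by (auto simp: subspace_def left_center_def br_add br_scale br_zero)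

lemma gl_iff:
  "D \<in> gl scale \<longleftrightarrow> (\<forall>a b. D (a + b) = D a + D b) \<and> (\<forall>c a. D (scale c a) = scale c (D a))"
  by (simp add: gl_def Vector_Spaces.linear_iff vector_space_axioms)

lemma gl_simps:
  assumes "D \<in> gl scale"
  shows "D (a + b) = D a + D b" "D (a - b) = D a - D b" "D 0 = 0"
    and "D (scale c a) = scale c (D a)"
proof -
  have add: "D (x + y) = D x + D y" for x y
    using assms by (simp add: gl_iff)
  show "D (a + b) = D a + D b" by (rule add)
  show "D (a - b) = D a - D b" using add[of "a - b" b] by (simp add: algebra_simps)
  show "D 0 = 0" using add[of 0 0] by simp
  show "D (scale c a) = scale c (D a)" using assms by (simp add: gl_iff)
qed

lemma commutator_gl:
  assumes "D \<in> gl scale" "E \<in> gl scale"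
  shows "commutator D E \<in> gl scale"
  unfolding gl_iff
  by (auto simp: commutator_def gl_simps[OF assms(1)] gl_simps[OF assms(2)]
      scale_right_diff_distrib)

lemma commutator_add_left:
  "E \<in> gl scale \<Longrightarrow> commutator (D + D') E = commutator D E + commutator D' E"
  by (rule ext) (simp add: commutator_def gl_simps)

lemma commutator_add_right:
  "D \<in> gl scale \<Longrightarrow> commutator D (E + E') = commutator D E + commutator D E'"
  by (rule ext) (simp add: commutator_def gl_simps)

lemma commutator_scale_left:
  "E \<in> gl scale \<Longrightarrow> commutator (\<lambda>a. scale c (D a)) E = (\<lambda>a. scale c (commutator D E a))"
  by (rule ext) (simp add: commutator_def gl_simps scale_right_diff_distrib)

lemma commutator_scale_right:
  "D \<in> gl scale \<Longrightarrow> commutator D (\<lambda>a. scale c (E a)) = (\<lambda>a. scale c (commutator D E a))"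
  by (rule ext) (simp add: commutator_def gl_simps scale_right_diff_distrib)

lemma commutator_jacobi:
  assumes "D \<in> gl scale" "E \<in> gl scale" "F \<in> gl scale"
  shows "commutator D (commutator E F) =
    commutator (commutator D E) F + commutator E (commutator D F)"
  by (rule ext)
    (simp add: commutator_def gl_simps[OF assms(1)] gl_simps[OF assms(2)] gl_simps[OF assms(3)])

lemma Der_L_D: "D \<in> Der_L scale br \<Longrightarrow> D (br a b) = br (D a) b + br a (D b)"
  by (simp add: Der_L_def)

lemma Der_R_D: "D \<in> Der_R scale br \<Longrightarrow> D (br a b) = br a (D b) - br b (D a)"
  by (simp add: Der_R_def)

lemma Der_L_gl: "D \<in> Der_L scale br \<Longrightarrow> D \<in> gl scale"
  by (simp add: Der_L_def)

lemma Der_R_gl: "D \<in> Der_R scale br \<Longrightarrow> D \<in> gl scale"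
  by (simp add: Der_R_def)

lemma commutator_Der_L:
  assumes "D \<in> Der_L scale br" "E \<in> Der_L scale br"
  shows "commutator D E \<in> Der_L scale br"
  using commutator_gl[OF assms[THEN Der_L_gl]]
  unfolding Der_L_def
  by (simp add: commutator_def Der_L_D[OF assms(1)] Der_L_D[OF assms(2)] br_diff
      gl_simps[OF Der_L_gl[OF assms(1)]] gl_simps[OF Der_L_gl[OF assms(2)]])

text \<open>
  Expanding \<open>D (E [a, b])\<close> and \<open>E (D [a, b])\<close> produces the same mixed terms
  \<open>[D a, E b] - [D b, E a]\<close>, which cancel and leave only terms in which \<open>D\<close> and \<open>E\<close> hit the same
  argument.
\<close>
lemma commutator_Der_R:
  assumes "D \<in> Der_L scale br" "E \<in> Der_R scale br"
  shows "commutator D E \<in> Der_R scale br"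
  using commutator_gl[OF Der_L_gl[OF assms(1)] Der_R_gl[OF assms(2)]]
  unfolding Der_R_def
  by (simp add: commutator_def Der_L_D[OF assms(1)] Der_R_D[OF assms(2)] br_diff
      gl_simps[OF Der_L_gl[OF assms(1)]] gl_simps[OF Der_R_gl[OF assms(2)]])

text \<open>For \<open>z\<close> in the left center, \<open>[D z, b] = D [z, b] - [z, D b] = 0\<close>.\<close>
lemma Der_L_left_center:
  assumes "D \<in> Der_L scale br" "z \<in> left_center br"
  shows "D z \<in> left_center br"
proof -
  have "br (D z) b = 0" for b
    using Der_L_D[OF assms(1), of z b] assms(2) gl_simps(3)[OF Der_L_gl[OF assms(1)]]
    by (simp add: left_center_def)
  then show ?thesis by (simp add: left_center_def)
qed

lemma vector_space_Der_scale: "vector_space (Der_scale scale)"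
  by unfold_locales
    (auto simp: Der_scale_def fun_eq_iff prod_eq_iff scale_right_distrib scale_left_distrib)

lemma subspace_Der: "module.subspace (Der_scale scale) (Der scale br)"
proof -
  interpret P: vector_space "Der_scale scale" by (rule vector_space_Der_scale)
  show ?thesis
  proof (rule P.subspaceI)
    show "0 \<in> Der scale br"
      by (simp add: Der_def Der_L_def Der_R_def gl_iff zero_prod_def br_zero)
  next
    fix P Q assume "P \<in> Der scale br" "Q \<in> Der scale br"
    then show "P + Q \<in> Der scale br"
      by (auto simp: Der_def Der_L_def Der_R_def gl_iff br_add scale_right_distrib)
  next
    fix c P assume "P \<in> Der scale br"
    then show "Der_scale scale c P \<in> Der scale br"
      by (auto simp: Der_def Der_L_def Der_R_def gl_iff Der_scale_def br_scale
          scale_right_distrib scale_right_diff_distrib mult.commute)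
  qed
qed

lemma Der_bracket_Der:
  "P \<in> Der scale br \<Longrightarrow> Q \<in> Der scale br \<Longrightarrow> Der_bracket P Q \<in> Der scale br"
  by (auto simp: Der_def Der_bracket_def intro: commutator_Der_L commutator_Der_R)

lemma Der_gl:
  assumes "P \<in> Der scale br"
  shows "fst P \<in> gl scale" "snd P \<in> gl scale"
  using assms by (auto simp: Der_def Der_L_def Der_R_def)

lemma leibniz_algebra_on_Der: "leibniz_algebra_on (Der_scale scale) (Der scale br) Der_bracket"
proof -
  interpret P: vector_space "Der_scale scale" by (rule vector_space_Der_scale)
  show ?thesis
  proof
    show "P.subspace (Der scale br)" by (rule subspace_Der)
  next
    fix P Q assume "P \<in> Der scale br" "Q \<in> Der scale br"
    then show "Der_bracket P Q \<in> Der scale br" by (rule Der_bracket_Der)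
  next
    fix P Q S assume "P \<in> Der scale br" "Q \<in> Der scale br" "S \<in> Der scale br"
    \<comment> \<open>Rewriting with a fixed instance of the Jacobi identity: its last summand has the
      shape of its left-hand side with \<open>D\<close> and \<open>E\<close> exchanged, so the general rule would loop.\<close>
    then show "Der_bracket P (Der_bracket Q S) =
        Der_bracket (Der_bracket P Q) S + Der_bracket Q (Der_bracket P S)"
      by (simp add: Der_bracket_def Der_gl commutator_jacobi[of "fst P" "fst Q"])
  qed (simp_all add: Der_bracket_def Der_scale_def Der_gl prod_eq_iff
      commutator_add_left commutator_add_right commutator_scale_left commutator_scale_right)
qed

lemma subspace_Xi: "module.subspace (Der_scale scale) (Xi scale br)"
proof -
  interpret P: vector_space "Der_scale scale" by (rule vector_space_Der_scale)
  show ?thesis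
  proof (rule P.subspaceI)
    show "0 \<in> Xi scale br"
      using P.subspace_0[OF subspace_Der] subspace_0[OF subspace_left_center]
      by (simp add: Xi_def zero_prod_def)
  next
    fix P Q assume PQ: "P \<in> Xi scale br" "Q \<in> Xi scale br"
    have "fst P a + fst Q a + (snd P a + snd Q a) \<in> left_center br" for a
      using subspace_add[OF subspace_left_center, of "fst P a + snd P a" "fst Q a + snd Q a"] PQ
      by (auto simp: Xi_def algebra_simps)
    then show "P + Q \<in> Xi scale br"
      using PQ P.subspace_add[OF subspace_Der, of P Q]
      by (auto simp: Xi_def)
  next
    fix c P assume P: "P \<in> Xi scale br"
    have "scale c (fst P a) + scale c (snd P a) \<in> left_center br" for a
      using subspace_scale[OF subspace_left_center, of "fst P a + snd P a" c] P
      by (auto simp: Xi_def scale_right_distrib)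
    then show "Der_scale scale c P \<in> Xi scale br"
      using P P.subspace_scale[OF subspace_Der, of P c]
      by (auto simp: Xi_def Der_scale_def)
  qed
qed

lemma Der_bracket_Xi:
  assumes P: "P \<in> Xi scale br" and Q: "Q \<in> Xi scale br"
  shows "Der_bracket P Q \<in> Xi scale br"
proof -
  obtain L\<^sub>1 R\<^sub>1 L\<^sub>2 R\<^sub>2 where PQ: "P = (L\<^sub>1, R\<^sub>1)" "Q = (L\<^sub>2, R\<^sub>2)"
    by (metis prod.exhaust)
  have L1: "L\<^sub>1 \<in> Der_L scale br" and R2: "R\<^sub>2 \<in> Der_R scale br"
    and sum: "L\<^sub>2 a + R\<^sub>2 a \<in> left_center br"
    and vanish: "z \<in> left_center br \<Longrightarrow> R\<^sub>2 z = 0" for a z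
    using P Q by (auto simp: PQ Xi_def Der_def)
  note lin = gl_simps[OF Der_L_gl[OF L1]]
  have "commutator L\<^sub>1 L\<^sub>2 a + commutator L\<^sub>1 R\<^sub>2 a \<in> left_center br" for a
  proof -
    have "commutator L\<^sub>1 L\<^sub>2 a + commutator L\<^sub>1 R\<^sub>2 a =
        L\<^sub>1 (L\<^sub>2 a + R\<^sub>2 a) - (L\<^sub>2 (L\<^sub>1 a) + R\<^sub>2 (L\<^sub>1 a))"
      by (simp add: commutator_def lin)
    also have "\<dots> \<in> left_center br"
      by (intro subspace_diff[OF subspace_left_center] Der_L_left_center[OF L1] sum)
    finally show ?thesis .
  qed
  moreover have "commutator L\<^sub>1 R\<^sub>2 z = 0" if "z \<in> left_center br" for z
    using that by (simp add: commutator_def vanish Der_L_left_center[OF L1] lin)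
  moreover have "Der_bracket P Q \<in> Der scale br"
    using P Q by (intro Der_bracket_Der) (auto simp: Xi_def)
  ultimately show ?thesis
    by (auto simp: Xi_def Der_bracket_def PQ)
qed

lemma sub_leibniz_algebra_Xi:
  "sub_leibniz_algebra (Der_scale scale) (Der scale br) Der_bracket (Xi scale br)"
  unfolding sub_leibniz_algebra_def
  using leibniz_algebra_on_Der subspace_Xi Der_bracket_Xi by (auto simp: Xi_def)

end

theorem proposition3p9:
  fixes scale :: "'k::field \<Rightarrow> 'h::ab_group_add \<Rightarrow> 'h"
    and br :: "'h \<Rightarrow> 'h \<Rightarrow> 'h"
  assumes "leibniz_algebra_on scale UNIV br"
  shows "sub_leibniz_algebra (Der_scale scale) (Der scale br) Der_bracket (Xi scale br)"
proof -
  interpret leibniz_algebra scale br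
    using assms by (rule leibniz_algebra.intro)
  show ?thesis by (rule sub_leibniz_algebra_Xi)
qed

end
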